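(* Let $(\tau_n)_{n\in\mathbb{N}}$ be, for each $\delta$, a random walk with $\tau_0=0$ and i.i.d. increments distributed as $\tau$, where $\mathsf{E}[\tau]=\delta\in(0,\infty)$ and $\mathsf{Var}[\tau]<\infty$, and let $\nu(t)=\inf\{n\in\mathbb{N}:\tau_n>t\}$ for $t>0$. If $\mathsf{Var}[\tau]=O(\delta^2)$ as $\delta\to\infty$, then $$\frac{\delta\,\nu(t)}{t}\longrightarrow 1 \quad\text{in } L^1\quad\text{as } \delta,t\to\infty \text{ so that } \delta=o(t).$$ When, in particular, $\mathsf{Var}[\tau]=O(\delta^{q})$ as $\delta\to\infty$ for some $q\in[0,2]$, then, as $\delta,t\to\infty$ so that $\delta=o(t)$, $$\mathsf{E}\Bigl[\Bigl|\frac{\delta\,\nu(t)}{t}-1\Bigr|\Bigr]=O\Bigl(\frac{\delta}{t}\Bigr)+O\Bigl(\sqrt{\frac{\delta^{q-1}}{t}}\Bigr).$$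
   Context: For each value of the drift $\delta>0$ (along values tending to infinity) there is a random walk $(\tau_n)_{n\in\mathbb{N}}$, $\tau_0:=0$, whose increments $(\tau_n-\tau_{n-1})$ are i.i.d. copies of $\tau:=\tau_1$; the law of $\tau$ depends on $\delta$, and $\tau$ is not necessarily positive. Order statements "as $\delta\to\infty$" refer to this family of laws. A statement "as $\delta,t\to\infty$ so that $\delta=o(t)$" refers to any joint limit in which $\delta\to\infty$, $t\to\infty$ and $\delta/t\to0$. *)

theory Defs
  imports "HOL-Probability.Probability"
begin

text \<open>The increments of the walk may take negative values.\<close>

locale random_walk = prob_space M for M :: "'a measure" +
  fixes \<tau> :: "nat \<Rightarrow> 'a \<Rightarrow> real"
  assumes measurable_walk: "\<And>n. \<tau> n \<in> borel_measurable M"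
    and walk_0: "\<And>\<omega>. \<omega> \<in> space M \<Longrightarrow> \<tau> 0 \<omega> = 0"
    and indep_increments: "indep_vars (\<lambda>_. borel) (\<lambda>n \<omega>. \<tau> (Suc n) \<omega> - \<tau> n \<omega>) UNIV"
    and increments_distr:
      "\<And>n. distr M borel (\<lambda>\<omega>. \<tau> (Suc n) \<omega> - \<tau> n \<omega>) = distr M borel (\<tau> 1)"

text \<open>If the walk never exceeds \<open>t\<close>, the infimum is taken over the empty set and equals \<open>\<infinity>\<close>.\<close>

definition first_passage :: "(nat \<Rightarrow> 'a \<Rightarrow> real) \<Rightarrow> real \<Rightarrow> 'a \<Rightarrow> enat" where
  "first_passage \<tau> t \<omega> = (INF n\<in>{n. \<tau> n \<omega> > t}. enat n)"

text \<open>
  The expectation of \<open>\<bar>\<delta> \<nu>(t) / t - 1\<bar>\<close>, i.e. the distance in \<open>L\<^sup>1\<close> between \<open>\<delta> \<nu>(t) / t\<close> and 1.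
  The random variable is \<open>\<infinity>\<close> where \<open>\<nu>(t) = \<infinity>\<close>, and the value is \<open>\<infinity>\<close> if it is not integrable.
\<close>

definition L1_deviation ::
    "'a measure \<Rightarrow> (nat \<Rightarrow> 'a \<Rightarrow> real) \<Rightarrow> real \<Rightarrow> real \<Rightarrow> ennreal" where
  "L1_deviation M \<tau> \<delta> t =
    (\<integral>\<^sup>+\<omega>. e2ennreal \<bar>ereal \<delta> * ereal_of_enat (first_passage \<tau> t \<omega>) / ereal t - 1\<bar> \<partial>M)"

text \<open>The limit \<open>\<delta> \<rightarrow> \<infinity>\<close> along the admissible drifts \<open>D\<close>.\<close>

definition drift_at_top :: "real set \<Rightarrow> real filter" where
  "drift_at_top D = inf at_top (principal D)"

text \<open>
  The joint limit \<open>\<delta>, t \<rightarrow> \<infinity>\<close> with \<open>\<delta> = o(t)\<close>, as the coarsest filter on pairs \<open>(\<delta>, t)\<close> along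
  which \<open>\<delta> \<rightarrow> \<infinity>\<close> within \<open>D\<close>, \<open>t \<rightarrow> \<infinity>\<close> and \<open>\<delta> / t \<rightarrow> 0\<close>. By the lemma below, convergence along
  this filter is convergence along every such joint limit.
\<close>

definition drift_time_limit :: "real set \<Rightarrow> (real \<times> real) filter" where
  "drift_time_limit D =
    inf (filtercomap fst (drift_at_top D))
      (inf (filtercomap snd at_top) (filtercomap (\<lambda>(\<delta>, t). \<delta> / t) (nhds 0)))"

lemma filterlim_drift_time_limit_iff:
  "filterlim (\<lambda>i. (\<delta> i, t i)) (drift_time_limit D) F \<longleftrightarrow>
    filterlim \<delta> at_top F \<and> (\<forall>\<^sub>F i in F. \<delta> i \<in> D) \<and>
    filterlim t at_top F \<and> ((\<lambda>i. \<delta> i / t i) \<longlongrightarrow> 0) F"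
  by (auto simp: drift_time_limit_def drift_at_top_def filterlim_inf filterlim_principal
      filterlim_filtercomap_iff o_def)

end

theory Submission imports Defs begin

text \<open>
  Let \<open>N = min(\<nu>(t), n)\<close>. Wald's identities for the bounded stopping time \<open>N\<close> say that
  \<open>\<tau>\<^sub>N - \<delta> N\<close> has mean \<open>0\<close> and second moment \<open>V E[N]\<close>, where \<open>V = Var[\<tau>]\<close>. Before the last step the
  walk is at most \<open>t\<close>, so \<open>\<tau>\<^sub>N \<le> t + \<delta> + W\<close>, where \<open>W\<^sup>2\<close> is the sum of the squared centred
  increments up to time \<open>N\<close> and \<open>E[W\<^sup>2] = V E[N]\<close> as well. Hence
  \<open>\<delta> E[N] \<le> t + \<delta> + (V E[N])\<^bsup>1/2\<^esup>\<close>, which by AM-GM bounds \<open>E[N]\<close> by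
  \<open>K = (2 t + 2 \<delta> + V / \<delta>) / \<delta>\<close> uniformly in \<open>n\<close>. On \<open>\<nu>(t) \<le> n\<close> moreover \<open>\<tau>\<^sub>N > t\<close>, so
  \<open>\<bar>\<delta> \<nu>(t) - t\<bar> \<le> \<bar>\<tau>\<^sub>N - \<delta> N\<bar> + \<delta> + W\<close>. Letting \<open>n \<rightarrow> \<infinity>\<close> yields
  \<open>E[\<bar>\<delta> \<nu>(t) - t\<bar>] \<le> \<delta> + 2 (V K)\<^bsup>1/2\<^esup>\<close>.
\<close>

section \<open>Preliminaries on second moments and independence\<close>

text \<open>This is the nonnegativity of the variance of \<open>\<bar>X\<bar>\<close>,
  rearranged.\<close>

lemma (in prob_space) expectation_abs_le_sqrt:
  fixes X :: "'a \<Rightarrow> real"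
  assumes "integrable M X" "integrable M (\<lambda>\<omega>. (X \<omega>)\<^sup>2)"
  shows "expectation (\<lambda>\<omega>. \<bar>X \<omega>\<bar>) \<le> sqrt (expectation (\<lambda>\<omega>. (X \<omega>)\<^sup>2))"
  using variance_eq[of "\<lambda>\<omega>. \<bar>X \<omega>\<bar>"] variance_positive[of "\<lambda>\<omega>. \<bar>X \<omega>\<bar>"] assms
  by (intro real_le_rsqrt) auto

text \<open>The index sets \<open>{..<n}\<close> and \<open>{n}\<close> are disjoint, so the past
  tuple and the next variable are independent, and so are functions of them.\<close>

lemma (in prob_space) indep_vars_mult_next:
  fixes X :: "nat \<Rightarrow> 'a \<Rightarrow> real" and G :: "real \<Rightarrow> real"
  assumes X: "indep_vars (\<lambda>_. borel) X UNIV"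
    and [measurable]: "F \<in> borel_measurable (PiM {..<n} (\<lambda>_. borel))" "G \<in> borel_measurable borel"
    and F: "integrable M (\<lambda>\<omega>. F (\<lambda>i\<in>{..<n}. X i \<omega>))" and G: "integrable M (\<lambda>\<omega>. G (X n \<omega>))"
  shows "integrable M (\<lambda>\<omega>. F (\<lambda>i\<in>{..<n}. X i \<omega>) * G (X n \<omega>))"
    and "expectation (\<lambda>\<omega>. F (\<lambda>i\<in>{..<n}. X i \<omega>) * G (X n \<omega>)) =
      expectation (\<lambda>\<omega>. F (\<lambda>i\<in>{..<n}. X i \<omega>)) * expectation (\<lambda>\<omega>. G (X n \<omega>))"
proof -
  have "indep_var (PiM {..<n} (\<lambda>_. borel)) (\<lambda>\<omega>. \<lambda>i\<in>{..<n}. X i \<omega>)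
      (PiM {n} (\<lambda>_. borel)) (\<lambda>\<omega>. \<lambda>i\<in>{n}. X i \<omega>)"
    by (rule indep_var_restrict[OF X]) auto
  from indep_var_compose[OF this assms(2), of "\<lambda>x. G (x n)" borel]
  have "indep_var borel (\<lambda>\<omega>. F (\<lambda>i\<in>{..<n}. X i \<omega>)) borel (\<lambda>\<omega>. G (X n \<omega>))"
    by (simp add: o_def)
  then show "integrable M (\<lambda>\<omega>. F (\<lambda>i\<in>{..<n}. X i \<omega>) * G (X n \<omega>))"
    and "expectation (\<lambda>\<omega>. F (\<lambda>i\<in>{..<n}. X i \<omega>) * G (X n \<omega>)) =
      expectation (\<lambda>\<omega>. F (\<lambda>i\<in>{..<n}. X i \<omega>)) * expectation (\<lambda>\<omega>. G (X n \<omega>))"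
    using F G by (auto intro: indep_var_integrable indep_var_lebesgue_integral)
qed

section \<open>Pathwise analysis of the stopped walk\<close>

text \<open>The indicator of the event \<open>\<nu>(t) > k\<close> for the walk with steps \<open>x\<close>.\<close>

definition alive :: "real \<Rightarrow> (nat \<Rightarrow> real) \<Rightarrow> nat \<Rightarrow> real" where
  "alive t x k = of_bool (\<forall>j\<le>k. sum x {..<j} \<le> t)"

text \<open>Predictability: survival up to \<open>k\<close> is decided by the steps
  \<open>0, ..., k - 1\<close>. This is what makes it independent of step \<open>k\<close>.\<close>

lemma alive_cong: "(\<And>i. i < k \<Longrightarrow> x i = y i) \<Longrightarrow> alive t x k = alive t y k"
  unfolding alive_def
  by (intro arg_cong[where f=of_bool] all_cong1 imp_cong refl arg_cong2[where f="(\<le>)"] sum.cong) auto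

lemma alive_cases: "alive t x k = 0 \<or> alive t x k = 1"
  by (auto simp: alive_def)

lemma alive_range [simp]: "0 \<le> alive t x k" "alive t x k \<le> 1"
  by (auto simp: alive_def)

lemma sum_alive_mult_eq: "alive t x n = 1 \<Longrightarrow> (\<Sum>k<n. alive t x k * f k) = (\<Sum>k<n. f k)"
  by (intro sum.cong) (auto simp: alive_def)

text \<open>After passage the left side is frozen. Before passage the walk is at most
  \<open>t\<close>, so one more step leads at most to \<open>t + d + (x n - d)\<close>, and the
  deviation \<open>x n - d\<close> is controlled by a single term of the sum of squares.\<close>

lemma stopped_sum_le:
  assumes "0 \<le> t" "0 \<le> d"
  shows "(\<Sum>k<n. alive t x k * x k) \<le> t + d + sqrt (\<Sum>k<n. alive t x k * (x k - d)\<^sup>2)"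
proof (induction n)
  case 0
  then show ?case using assms by simp
next
  case (Suc n)
  consider "alive t x n = 0" | "alive t x n = 1" by (auto simp: alive_def)
  then show ?case
  proof cases
    case 1
    then show ?thesis using Suc by simp
  next
    case 2
    have "sum x {..<n} \<le> t" using 2 by (simp add: alive_def split: if_splits)
    then have "(\<Sum>k<Suc n. alive t x k * x k) \<le> t + d + sqrt ((x n - d)\<^sup>2)"
      using 2 sum_alive_mult_eq[OF 2, of x] by simp
    also have "sqrt ((x n - d)\<^sup>2) \<le> sqrt (\<Sum>k<Suc n. alive t x k * (x k - d)\<^sup>2)"
      using 2 by (intro real_sqrt_le_mono) (auto intro!: sum_nonneg)
    finally show ?thesis by simp
  qed
qed

text \<open>Once passage has occurred by time \<open>n\<close>, the weighted sums stop exactly at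
  the first passage index, so the count of surviving times is the passage time itself.\<close>

lemma stopped_sum_gt:
  assumes "alive t x n = 0"
  shows "(\<Sum>k<n. alive t x k * x k) > t"
    and "\<exists>p. (INF k\<in>{k. sum x {..<k} > t}. enat k) = enat p \<and> (\<Sum>k<n. alive t x k) = real p"
proof -
  define q where "q = (LEAST k. sum x {..<k} > t)"
  obtain j where j: "j \<le> n" "sum x {..<j} > t" using assms by (auto simp: alive_def not_le)
  have q: "sum x {..<q} > t" unfolding q_def by (rule LeastI) (rule j)
  have least: "q \<le> k" if "sum x {..<k} > t" for k unfolding q_def by (rule Least_le) (rule that)
  have "q \<le> n" using least[OF j(2)] j by simp
  \<comment> \<open>With \<open>q\<close> the first passage index, the weights cut a sum over
    \<open>k < n\<close> down to a sum over \<open>k < q\<close>, since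
    \<open>q \<le> n\<close>.\<close>
  have al: "alive t x k = of_bool (k < q)" for k
  proof (cases "k < q")
    case True
    then have "sum x {..<j} \<le> t" if "j \<le> k" for j using that least[of j] by force
    with True show ?thesis by (simp add: alive_def)
  next
    case False
    then show ?thesis using q by (auto simp: alive_def not_less not_le)
  qed
  have stopped: "(\<Sum>k<n. alive t x k * f k) = sum f {..<q}" for f
    unfolding al using \<open>q \<le> n\<close> by (intro sum.mono_neutral_cong_right) auto
  show "(\<Sum>k<n. alive t x k * x k) > t" using stopped[of x] q by simp
  have "(\<Sum>k<n. alive t x k) = q" using stopped[of "\<lambda>_. 1"] by simp
  moreover have "(INF k\<in>{k. sum x {..<k} > t}. enat k) = enat q"
    by (intro antisym INF_lower INF_greatest) (use q least in auto)
  ultimately show "\<exists>p. (INF k\<in>{k. sum x {..<k} > t}. enat k) = enat p \<and> (\<Sum>k<n. alive t x k) = real p"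
    by blast
qed

lemma measurable_alive [measurable]:
  assumes "\<And>i. i < k \<Longrightarrow> (\<lambda>\<omega>. X \<omega> i) \<in> borel_measurable N"
  shows "(\<lambda>\<omega>. alive t (X \<omega>) k) \<in> borel_measurable N"
proof -
  have [measurable]: "(\<lambda>\<omega>. sum (X \<omega>) {..<j}) \<in> borel_measurable N" if "j \<in> {..k}" for j
    using assms that by (intro borel_measurable_sum) auto
  have "Measurable.pred N (\<lambda>\<omega>. \<forall>j\<in>{..k}. sum (X \<omega>) {..<j} \<le> t)"
    by (intro pred_intros_finite) measurable
  then show ?thesis unfolding alive_def by (simp add: Ball_def )
qed

lemma alive_antimono: "m \<le> n \<Longrightarrow> alive t x n \<le> alive t x m"
  by (auto simp: alive_def)

section \<open>A single walk with drift: its increments and their independence of the past\<close>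

locale drift_walk = random_walk M \<tau> for M :: "'a measure" and \<tau> +
  fixes \<delta> :: real
  assumes drift_pos: "\<delta> > 0"
    and integrable_1: "integrable M (\<tau> 1)"
    and expectation_1: "expectation (\<tau> 1) = \<delta>"
    and integrable_square_1: "integrable M (\<lambda>\<omega>. (\<tau> 1 \<omega>)\<^sup>2)"
begin

definition step :: "'a \<Rightarrow> nat \<Rightarrow> real" where
  "step \<omega> n = \<tau> (Suc n) \<omega> - \<tau> n \<omega>"

lemma measurable_step [measurable]: "(\<lambda>\<omega>. step \<omega> n) \<in> borel_measurable M"
  unfolding step_def using measurable_walk by measurable

lemma sum_step: "\<omega> \<in> space M \<Longrightarrow> sum (step \<omega>) {..<n} = \<tau> n \<omega>"
  by (induction n) (simp_all add: step_def walk_0)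

lemma distr_step: "distr M borel (\<lambda>\<omega>. step \<omega> n) = distr M borel (\<tau> 1)"
  unfolding step_def by (rule increments_distr)

lemma
  fixes f :: "real \<Rightarrow> real"
  assumes [measurable]: "f \<in> borel_measurable borel"
  shows integrable_step_iff: "integrable M (\<lambda>\<omega>. f (step \<omega> n)) \<longleftrightarrow> integrable M (\<lambda>\<omega>. f (\<tau> 1 \<omega>))"
    and expectation_step: "expectation (\<lambda>\<omega>. f (step \<omega> n)) = expectation (\<lambda>\<omega>. f (\<tau> 1 \<omega>))"
proof -
  note [measurable] = measurable_walk[of 1]
  show "integrable M (\<lambda>\<omega>. f (step \<omega> n)) \<longleftrightarrow> integrable M (\<lambda>\<omega>. f (\<tau> 1 \<omega>))"
    using arg_cong[OF distr_step[of n], of "\<lambda>N. integrable N f"] by (simp add: integrable_distr_eq del: One_nat_def)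
  show "expectation (\<lambda>\<omega>. f (step \<omega> n)) = expectation (\<lambda>\<omega>. f (\<tau> 1 \<omega>))"
    using arg_cong[OF distr_step[of n], of "\<lambda>N. integral\<^sup>L N f"] by (simp add: integral_distr del: One_nat_def)
qed

definition V :: real where "V = variance (\<tau> 1)"

lemma V_nonneg: "0 \<le> V"
  unfolding V_def by (rule variance_positive)

lemma step_moments:
  shows "integrable M (\<lambda>\<omega>. step \<omega> n - \<delta>)"
    and "expectation (\<lambda>\<omega>. step \<omega> n - \<delta>) = 0"
    and "integrable M (\<lambda>\<omega>. (step \<omega> n - \<delta>)\<^sup>2)"
    and "expectation (\<lambda>\<omega>. (step \<omega> n - \<delta>)\<^sup>2) = V"
  using integrable_step_iff[of "\<lambda>x. x - \<delta>" n] expectation_step[of "\<lambda>x. x - \<delta>" n]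
    integrable_step_iff[of "\<lambda>x. (x - \<delta>)\<^sup>2" n] expectation_step[of "\<lambda>x. (x - \<delta>)\<^sup>2" n]
    integrable_1 expectation_1 integrable_square_1
  by (simp_all add: prob_space power2_diff V_def)

text \<open>The tuple restricted to \<open>{..<n}\<close> is undefined elsewhere; the assumption
  \<open>past\<close> allows it to be replaced by the full step sequence.\<close>

lemma
  fixes F :: "(nat \<Rightarrow> real) \<Rightarrow> real" and G :: "real \<Rightarrow> real"
  assumes [measurable]: "F \<in> borel_measurable (PiM {..<n} (\<lambda>_. borel))" "G \<in> borel_measurable borel"
    and past: "\<And>x y. (\<And>i. i < n \<Longrightarrow> x i = y i) \<Longrightarrow> F x = F y"
    and F: "integrable M (\<lambda>\<omega>. F (step \<omega>))" and G: "integrable M (\<lambda>\<omega>. G (step \<omega> n))"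
  shows integrable_past_mult: "integrable M (\<lambda>\<omega>. F (step \<omega>) * G (step \<omega> n))"
    and expectation_past_mult: "expectation (\<lambda>\<omega>. F (step \<omega>) * G (step \<omega> n)) =
      expectation (\<lambda>\<omega>. F (step \<omega>)) * expectation (\<lambda>\<omega>. G (step \<omega> n))"
proof -
  have X: "indep_vars (\<lambda>_. borel) (\<lambda>n \<omega>. step \<omega> n) UNIV"
    unfolding step_def by (rule indep_increments)
  have "F (\<lambda>i\<in>{..<n}. step \<omega> i) = F (step \<omega>)" for \<omega>
    by (rule past) auto
  with indep_vars_mult_next[OF X assms(1,2)] F G
  show "integrable M (\<lambda>\<omega>. F (step \<omega>) * G (step \<omega> n))"
    "expectation (\<lambda>\<omega>. F (step \<omega>) * G (step \<omega> n)) =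
      expectation (\<lambda>\<omega>. F (step \<omega>)) * expectation (\<lambda>\<omega>. G (step \<omega> n))"
    by simp_all
qed

lemma measurable_alive_step [measurable]: "(\<lambda>\<omega>. alive t (step \<omega>) k) \<in> borel_measurable M"
  by (rule measurable_alive) simp

lemma integrable_alive_step [simp]: "integrable M (\<lambda>\<omega>. alive t (step \<omega>) k)"
  by (rule integrable_const_bound[of _ 1]) auto

lemma measurable_alive_PiM [measurable]:
  "k \<le> n \<Longrightarrow> (\<lambda>x. alive t x k) \<in> borel_measurable (PiM {..<n} (\<lambda>_. borel))"
  by (rule measurable_alive) (auto intro!: measurable_component_singleton)

text \<open>Step \<open>n\<close> is independent of the event that passage has not occurred by time
  \<open>n\<close>, which is the factorisation behind both Wald identities.\<close>

lemma
  fixes G :: "real \<Rightarrow> real"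
  assumes "G \<in> borel_measurable borel" "integrable M (\<lambda>\<omega>. G (step \<omega> n))"
  shows integrable_alive_mult: "integrable M (\<lambda>\<omega>. alive t (step \<omega>) n * G (step \<omega> n))"
    and expectation_alive_mult: "expectation (\<lambda>\<omega>. alive t (step \<omega>) n * G (step \<omega> n)) =
      expectation (\<lambda>\<omega>. alive t (step \<omega>) n) * expectation (\<lambda>\<omega>. G (step \<omega> n))"
  using integrable_past_mult[OF measurable_alive_PiM assms(1) alive_cong _ assms(2)]
    expectation_past_mult[OF measurable_alive_PiM assms(1) alive_cong _ assms(2)] by simp_all

section \<open>Wald identities for the stopped walk\<close>

definition stopped_mart :: "real \<Rightarrow> nat \<Rightarrow> (nat \<Rightarrow> real) \<Rightarrow> real" where
  "stopped_mart t n x = (\<Sum>k<n. alive t x k * (x k - \<delta>))"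

text \<open>The expectation of \<open>min(\<nu>(t), n)\<close>.\<close>

definition stopped_mean :: "real \<Rightarrow> nat \<Rightarrow> real" where
  "stopped_mean t n = (\<Sum>k<n. expectation (\<lambda>\<omega>. alive t (step \<omega>) k))"

lemma stopped_mean_nonneg: "0 \<le> stopped_mean t n"
  unfolding stopped_mean_def by (intro sum_nonneg integral_nonneg) auto

lemma measurable_stopped_mart [measurable]: "(\<lambda>\<omega>. stopped_mart t n (step \<omega>)) \<in> borel_measurable M"
  unfolding stopped_mart_def by measurable

lemma measurable_stopped_mart_PiM [measurable]:
  "stopped_mart t n \<in> borel_measurable (PiM {..<n} (\<lambda>_. borel))"
  unfolding stopped_mart_def
  by (intro borel_measurable_sum borel_measurable_times borel_measurable_diff borel_measurable_const
      measurable_alive_PiM measurable_component_singleton) auto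

lemma stopped_mart_cong: "(\<And>i. i < n \<Longrightarrow> x i = y i) \<Longrightarrow> stopped_mart t n x = stopped_mart t n y"
  unfolding stopped_mart_def by (intro sum.cong) (auto intro!: arg_cong2[where f="(*)"] alive_cong)

text \<open>Wald's first identity: every summand is a past event's indicator times a centred step,
  so its mean factorises to 0.\<close>

lemma stopped_mart:
  shows integrable_stopped_mart: "integrable M (\<lambda>\<omega>. stopped_mart t n (step \<omega>))"
    and expectation_stopped_mart: "expectation (\<lambda>\<omega>. stopped_mart t n (step \<omega>)) = 0"
  using integrable_alive_mult[of "\<lambda>x. x - \<delta>"] expectation_alive_mult[of "\<lambda>x. x - \<delta>"] step_moments
  unfolding stopped_mart_def by (simp_all add: Bochner_Integration.integral_sum)

text \<open>Wald's second identity: the martingale increments are orthogonal, so only the squared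
  steps contribute, each with mean \<open>V\<close> times a survival probability.\<close>

lemma stopped_mart_square:
  "integrable M (\<lambda>\<omega>. (stopped_mart t n (step \<omega>))\<^sup>2) \<and>
    expectation (\<lambda>\<omega>. (stopped_mart t n (step \<omega>))\<^sup>2) = V * stopped_mean t n"
proof (induction n)
  case 0
  then show ?case by (simp add: stopped_mart_def stopped_mean_def)
next
  case (Suc n)
  let ?F = "\<lambda>x. stopped_mart t n x * alive t x n"
  have meas: "?F \<in> borel_measurable (PiM {..<n} (\<lambda>_. borel))"
    by (intro borel_measurable_times measurable_stopped_mart_PiM measurable_alive_PiM) simp
  have int: "integrable M (\<lambda>\<omega>. ?F (step \<omega>))"
    by (rule Bochner_Integration.integrable_bound[OF integrable_stopped_mart[of t n]])
      (auto simp: abs_mult intro!: mult_left_le)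
  have past: "?F x = ?F y" if "\<And>i. i < n \<Longrightarrow> x i = y i" for x y
    using stopped_mart_cong[OF that, of n] alive_cong[OF that, of n] by simp
  note cross = integrable_past_mult[OF meas _ past int, of "\<lambda>x. x - \<delta>"]
    expectation_past_mult[OF meas _ past int, of "\<lambda>x. x - \<delta>"]
  \<comment> \<open>The weight is 0 or 1, hence equal to its square; the middle term is a function
    of the past times a centred step and has mean 0.\<close>
  have eq: "(stopped_mart t (Suc n) x)\<^sup>2 =
      (stopped_mart t n x)\<^sup>2 + 2 * (?F x * (x n - \<delta>)) + alive t x n * (x n - \<delta>)\<^sup>2" for x
    using alive_cases[of t x n] by (auto simp: stopped_mart_def power2_sum)
  show ?case
    unfolding eq using Suc cross step_moments integrable_alive_mult[of "\<lambda>x. (x - \<delta>)\<^sup>2" n t]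
      expectation_alive_mult[of "\<lambda>x. (x - \<delta>)\<^sup>2" n t]
    by (simp add: stopped_mean_def distrib_left mult.commute[of V])
qed

section \<open>Control of the overshoot\<close>

text \<open>
  The sum of squares dominates the last deviation \<open>x\<^sub>N\<^sub>-\<^sub>1 - \<delta>\<close>, hence the overshoot, yet it has
  the same mean as the square of the stopped martingale.
\<close>

definition overshoot_bound :: "real \<Rightarrow> nat \<Rightarrow> (nat \<Rightarrow> real) \<Rightarrow> real" where
  "overshoot_bound t n x = sqrt (\<Sum>k<n. alive t x k * (x k - \<delta>)\<^sup>2)"

lemma measurable_overshoot_bound [measurable]:
  "(\<lambda>\<omega>. overshoot_bound t n (step \<omega>)) \<in> borel_measurable M"
  unfolding overshoot_bound_def by measurable

lemma overshoot_bound_nonneg [simp]: "0 \<le> overshoot_bound t n x"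
  unfolding overshoot_bound_def by (intro real_sqrt_ge_zero sum_nonneg) auto

lemma overshoot_bound_square:
  shows "integrable M (\<lambda>\<omega>. (overshoot_bound t n (step \<omega>))\<^sup>2)"
    and "expectation (\<lambda>\<omega>. (overshoot_bound t n (step \<omega>))\<^sup>2) = V * stopped_mean t n"
proof -
  have eq: "(overshoot_bound t n x)\<^sup>2 = (\<Sum>k<n. alive t x k * (x k - \<delta>)\<^sup>2)" for x
    unfolding overshoot_bound_def by (intro real_sqrt_pow2 sum_nonneg) auto
  show "integrable M (\<lambda>\<omega>. (overshoot_bound t n (step \<omega>))\<^sup>2)"
    "expectation (\<lambda>\<omega>. (overshoot_bound t n (step \<omega>))\<^sup>2) = V * stopped_mean t n"
    using integrable_alive_mult[of "\<lambda>x. (x - \<delta>)\<^sup>2"] expectation_alive_mult[of "\<lambda>x. (x - \<delta>)\<^sup>2"]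
      step_moments unfolding eq
    by (simp_all add: Bochner_Integration.integral_sum stopped_mean_def sum_distrib_left mult.commute[of V])
qed

lemma integrable_overshoot_bound: "integrable M (\<lambda>\<omega>. overshoot_bound t n (step \<omega>))"
  by (rule square_integrable_imp_integrable[OF measurable_overshoot_bound overshoot_bound_square(1)])

lemma expectation_overshoot_bound_le:
  "expectation (\<lambda>\<omega>. overshoot_bound t n (step \<omega>)) \<le> sqrt (V * stopped_mean t n)"
  using expectation_abs_le_sqrt[OF integrable_overshoot_bound overshoot_bound_square(1)]
  by (simp add: overshoot_bound_square)

lemma expectation_abs_stopped_mart_le:
  "expectation (\<lambda>\<omega>. \<bar>stopped_mart t n (step \<omega>)\<bar>) \<le> sqrt (V * stopped_mean t n)"
  using expectation_abs_le_sqrt[OF integrable_stopped_mart conjunct1[OF stopped_mart_square]]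
  by (simp add: stopped_mart_square)

section \<open>Mean of the stopped time and almost sure passage\<close>

lemma stopped_sum_eq:
  "(\<Sum>k<n. alive t x k * x k) = stopped_mart t n x + \<delta> * (\<Sum>k<n. alive t x k)"
  by (induction n) (simp_all add: stopped_mart_def algebra_simps)

definition mean_bound :: "real \<Rightarrow> real" where
  "mean_bound t = (2 * t + 2 * \<delta> + V / \<delta>) / \<delta>"

lemma stopped_mean_le:
  assumes "0 \<le> t"
  shows "stopped_mean t n \<le> mean_bound t"
proof -
  let ?m = "stopped_mean t n"
  have "\<delta> * ?m = expectation (\<lambda>\<omega>. stopped_mart t n (step \<omega>) + \<delta> * (\<Sum>k<n. alive t (step \<omega>) k))"
    using stopped_mart by (simp add: stopped_mean_def Bochner_Integration.integral_sum)
  also have "\<dots> \<le> expectation (\<lambda>\<omega>. t + \<delta> + overshoot_bound t n (step \<omega>))"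
    using integrable_overshoot_bound stopped_mart
      stopped_sum_le[OF assms less_imp_le[OF drift_pos], folded overshoot_bound_def, unfolded stopped_sum_eq]
    by (intro integral_mono) auto
  also have "\<dots> \<le> t + \<delta> + sqrt (V * ?m)"
    using expectation_overshoot_bound_le integrable_overshoot_bound by (simp add: prob_space)
  \<comment> \<open>This splitting makes AM-GM produce half of \<open>\<delta> * ?m\<close>, which
    the left side absorbs; solving for \<open>?m\<close> gives \<open>mean_bound t\<close>.\<close>
  also have "sqrt (V * ?m) = sqrt ((V / \<delta>) * (\<delta> * ?m))"
    using drift_pos by simp
  also have "\<dots> \<le> (V / \<delta> + \<delta> * ?m) / 2"
    using V_nonneg drift_pos stopped_mean_nonneg by (intro arith_geo_mean_sqrt) auto
  finally show ?thesis
    using drift_pos by (simp add: mean_bound_def field_simps)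
qed

text \<open>The partial sums of the survival probabilities are bounded by
  \<open>mean_bound t\<close>, so these probabilities tend to 0, and each dominates the probability
  of never passing \<open>t\<close>.\<close>

lemma AE_not_alive:
  assumes "0 \<le> t"
  shows "AE \<omega> in M. \<exists>n. alive t (step \<omega>) n = 0"
proof -
  let ?B = "{\<omega> \<in> space M. \<forall>n. alive t (step \<omega>) n = 1}"
  have B [measurable]: "?B \<in> sets M" by measurable
  have "summable (\<lambda>k. expectation (\<lambda>\<omega>. alive t (step \<omega>) k))"
    using stopped_mean_le[OF assms] unfolding stopped_mean_def
    by (intro summableI_nonneg_bounded[of _ "mean_bound t"]) auto
  then have "(\<lambda>k. expectation (\<lambda>\<omega>. alive t (step \<omega>) k)) \<longlonglongrightarrow> 0"
    by (rule summable_LIMSEQ_zero)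
  moreover have "prob ?B \<le> expectation (\<lambda>\<omega>. alive t (step \<omega>) k)" for k
  proof -
    have "prob ?B = expectation (indicator ?B)" by simp
    also have "\<dots> \<le> expectation (\<lambda>\<omega>. alive t (step \<omega>) k)"
    proof (intro integral_mono integrable_real_indicator[OF B] integrable_alive_step)
      show "indicator ?B \<omega> \<le> alive t (step \<omega>) k" if "\<omega> \<in> space M" for \<omega>
        using that by (auto simp: indicator_def)
    qed (simp add: less_top[symmetric])
    finally show ?thesis .
  qed
  ultimately have "prob ?B \<le> 0"
    by (intro LIMSEQ_le_const) auto
  then have "AE \<omega> in M. \<not> (\<forall>n. alive t (step \<omega>) n = 1)"
    using prob_eq_0[OF B] measure_nonneg[of M ?B] by simp
  then show ?thesis
    by eventually_elim (use alive_cases in blast)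
qed

section \<open>Explicit bounds on the deviation in mean\<close>

text \<open>Monotone convergence carries estimates that are uniform in the truncation
  \<open>n\<close> over to the untruncated passage time.\<close>

lemma L1_deviation_le:
  assumes t: "0 < t"
  shows "L1_deviation M \<tau> \<delta> t \<le> ennreal ((\<delta> + 2 * sqrt (V * mean_bound t)) / t)"
proof -
  let ?D = "\<lambda>\<omega>. e2ennreal \<bar>ereal \<delta> * ereal_of_enat (first_passage \<tau> t \<omega>) / ereal t - 1\<bar>"
  \<comment> \<open>\<open>Y n\<close> is the deviation on the event of passage by time
    \<open>n\<close> and 0 elsewhere, so it increases to the full deviation almost surely.\<close>
  define Y where "Y n \<omega> = ennreal ((1 - alive t (step \<omega>) n) * (\<bar>\<delta> * (\<Sum>k<n. alive t (step \<omega>) k) - t\<bar> / t))"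
    for n \<omega>
  have [measurable]: "Y n \<in> borel_measurable M" for n
    unfolding Y_def by measurable
  have Y_alive: "Y n \<omega> = 0" if "alive t (step \<omega>) n = 1" for n \<omega>
    using that by (simp add: Y_def)
  have Y_eq: "Y n \<omega> = ?D \<omega>" if \<omega>: "\<omega> \<in> space M" and dead: "alive t (step \<omega>) n = 0" for n \<omega>
  proof -
    obtain p where p: "first_passage \<tau> t \<omega> = enat p" "(\<Sum>k<n. alive t (step \<omega>) k) = real p"
      using stopped_sum_gt(2)[OF dead] \<omega> by (auto simp: first_passage_def sum_step)
    have "\<bar>\<delta> * real p - t\<bar> / t = \<bar>\<delta> * real p / t - 1\<bar>"
      using t abs_divide[of "\<delta> * real p - t" t] by (simp add: diff_divide_distrib)
    then show ?thesis
      using dead p t by (simp add: Y_def one_ereal_def e2ennreal_ereal)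
  qed
  have Y_mono: "Y n \<omega> \<le> Y (Suc n) \<omega>" if "\<omega> \<in> space M" for n \<omega>
  proof (cases "alive t (step \<omega>) n = 1")
    case False
    then have n: "alive t (step \<omega>) n = 0" using alive_cases by blast
    moreover have "alive t (step \<omega>) (Suc n) = 0"
      using n alive_antimono[of n "Suc n" t "step \<omega>"] by (intro antisym) auto
    ultimately show ?thesis using Y_eq[OF that] by simp
  qed (simp add: Y_alive)
  have "AE \<omega> in M. ?D \<omega> = (SUP n. Y n \<omega>)"
    using AE_not_alive[OF less_imp_le[OF t]] AE_space
  proof eventually_elim
    case (elim \<omega>)
    then obtain n where n: "alive t (step \<omega>) n = 0" by blast
    have "Y k \<omega> \<le> ?D \<omega>" for k
      using Y_alive[of \<omega> k] Y_eq[OF elim(2), of k] alive_cases[of t "step \<omega>" k] by force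
    then show ?case
      using Y_eq[OF elim(2) n] by (intro antisym SUP_least) (auto intro: SUP_upper2[of n])
  qed
  then have "L1_deviation M \<tau> \<delta> t = (\<integral>\<^sup>+\<omega>. (SUP n. Y n \<omega>) \<partial>M)"
    unfolding L1_deviation_def by (rule nn_integral_cong_AE)
  also have "\<dots> = (SUP n. \<integral>\<^sup>+\<omega>. Y n \<omega> \<partial>M)"
    using Y_mono by (intro nn_integral_monotone_convergence_SUP_AE) auto
  also have "\<dots> \<le> ennreal ((\<delta> + 2 * sqrt (V * mean_bound t)) / t)"
  proof (rule SUP_least)
    fix n
    let ?B = "\<lambda>\<omega>. (\<bar>stopped_mart t n (step \<omega>)\<bar> + \<delta> + overshoot_bound t n (step \<omega>)) / t"
    have int: "integrable M ?B"
      using integrable_stopped_mart integrable_overshoot_bound by auto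
    have "Y n \<omega> \<le> ennreal (?B \<omega>)" for \<omega>
    proof (cases "alive t (step \<omega>) n = 1")
      case False
      then have dead: "alive t (step \<omega>) n = 0" using alive_cases by blast
      \<comment> \<open>The lower estimate uses that the stopped walk exceeds \<open>t\<close>, the
        upper one that its overshoot is at most \<open>\<delta>\<close> plus the overshoot
        bound.\<close>
      have "\<bar>\<delta> * (\<Sum>k<n. alive t (step \<omega>) k) - t\<bar>
          \<le> \<bar>stopped_mart t n (step \<omega>)\<bar> + \<delta> + overshoot_bound t n (step \<omega>)"
        using stopped_sum_gt(1)[OF dead] stopped_sum_eq[of t "step \<omega>" n]
          stopped_sum_le[of t \<delta> "step \<omega>" n, folded overshoot_bound_def] drift_pos t by linarith
      then show ?thesis
        using t dead by (simp add: Y_def divide_right_mono)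
    qed (simp add: Y_alive)
    then have "(\<integral>\<^sup>+\<omega>. Y n \<omega> \<partial>M) \<le> (\<integral>\<^sup>+\<omega>. ennreal (?B \<omega>) \<partial>M)"
      by (intro nn_integral_mono) simp
    also have "\<dots> = ennreal (expectation ?B)"
      using int t drift_pos by (intro nn_integral_eq_integral) (auto intro!: AE_I2 divide_nonneg_pos add_nonneg_nonneg)
    also have "expectation ?B = (expectation (\<lambda>\<omega>. \<bar>stopped_mart t n (step \<omega>)\<bar>) + \<delta>
        + expectation (\<lambda>\<omega>. overshoot_bound t n (step \<omega>))) / t"
      using integrable_stopped_mart integrable_overshoot_bound by (simp add: prob_space)
    also have "\<dots> \<le> (sqrt (V * stopped_mean t n) + \<delta> + sqrt (V * stopped_mean t n)) / t"
      using expectation_abs_stopped_mart_le expectation_overshoot_bound_le t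
      by (intro divide_right_mono add_mono) auto
    also have "sqrt (V * stopped_mean t n) \<le> sqrt (V * mean_bound t)"
      using stopped_mean_le[of t n] V_nonneg t by (intro real_sqrt_le_mono mult_left_mono) auto
    finally show "(\<integral>\<^sup>+\<omega>. Y n \<omega> \<partial>M) \<le> ennreal ((\<delta> + 2 * sqrt (V * mean_bound t)) / t)"
      using t by (simp add: divide_right_mono ennreal_leI add.commute)
  qed
  finally show ?thesis .
qed

text \<open>Since \<open>q \<le> 2\<close> and \<open>1 \<le> \<delta> \<le> t\<close>, the three
  terms of \<open>mean_bound t\<close> are at most \<open>2 * t / \<delta>\<close>,
  \<open>2 * t / \<delta>\<close> and \<open>C * t / \<delta>\<close>, whence the factor
  \<open>4 + C\<close>.\<close>

lemma L1_deviation_le_powr: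
  assumes V: "variance (\<tau> 1) \<le> C * \<delta> powr q" and "0 \<le> C" "q \<le> 2" "1 \<le> \<delta>" "\<delta> \<le> t"
  shows "L1_deviation M \<tau> \<delta> t
    \<le> ennreal (\<delta> / t + 2 * sqrt (C * (4 + C)) * sqrt (\<delta> powr (q - 1) / t))"
proof -
  have t: "0 < t" using assms by simp
  have "V / \<delta> \<le> C * \<delta> powr 2 / \<delta>"
    using V powr_mono[OF \<open>q \<le> 2\<close> \<open>1 \<le> \<delta>\<close>] \<open>0 \<le> C\<close> drift_pos unfolding V_def
    by (intro divide_right_mono) (auto intro: order_trans mult_left_mono)
  also have "\<dots> = C * \<delta>" using drift_pos by (simp add: power2_eq_square)
  also have "\<dots> \<le> C * t" using assms by (intro mult_left_mono)
  finally have K: "mean_bound t \<le> (4 + C) * t / \<delta>"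
    unfolding mean_bound_def using drift_pos \<open>\<delta> \<le> t\<close> by (intro divide_right_mono) (auto simp: algebra_simps)
  have "V * mean_bound t \<le> (C * \<delta> powr q) * ((4 + C) * t / \<delta>)"
    using V_nonneg V K assms t drift_pos unfolding V_def mean_bound_def
    by (intro mult_mono) auto
  \<comment> \<open>The square of \<open>t\<close> is split off so that its root cancels the
    division by \<open>t\<close> in the deviation bound.\<close>
  also have "\<dots> = (C * (4 + C)) * (\<delta> powr (q - 1) / t) * t\<^sup>2"
    using t drift_pos by (simp add: powr_diff power2_eq_square)
  finally have "sqrt (V * mean_bound t) \<le> sqrt (C * (4 + C)) * sqrt (\<delta> powr (q - 1) / t) * t"
    using t by (metis real_sqrt_le_mono real_sqrt_mult real_sqrt_abs abs_of_pos)
  then have "(\<delta> + 2 * sqrt (V * mean_bound t)) / t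
      \<le> \<delta> / t + 2 * sqrt (C * (4 + C)) * sqrt (\<delta> powr (q - 1) / t)"
    using t by (simp add: field_simps)
  with L1_deviation_le[OF t] show ?thesis
    using order_trans ennreal_leI by blast
qed

end

section \<open>Passage to the joint limit\<close>

lemma filterlim_drift_time_limit:
  shows "filterlim fst (drift_at_top D) (drift_time_limit D)"
    and "filterlim snd at_top (drift_time_limit D)"
    and "((\<lambda>p. fst p / snd p) \<longlongrightarrow> 0) (drift_time_limit D)"
  using filterlim_drift_time_limit_iff[of fst snd D "drift_time_limit D"]
  by (auto simp: filterlim_ident drift_at_top_def filterlim_inf filterlim_principal)

theorem theorem2p1:
  fixes D :: "real set"
    and M :: "real \<Rightarrow> 'a measure"
    and \<tau> :: "real \<Rightarrow> nat \<Rightarrow> 'a \<Rightarrow> real"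
  assumes D_pos: "D \<subseteq> {0<..}"
    and D_unbounded: "\<not> bdd_above D"
    and walk: "\<And>\<delta>. \<delta> \<in> D \<Longrightarrow> random_walk (M \<delta>) (\<tau> \<delta>)"
    and mean_integrable: "\<And>\<delta>. \<delta> \<in> D \<Longrightarrow> integrable (M \<delta>) (\<tau> \<delta> 1)"
    and mean: "\<And>\<delta>. \<delta> \<in> D \<Longrightarrow> prob_space.expectation (M \<delta>) (\<tau> \<delta> 1) = \<delta>"
    and finite_variance: "\<And>\<delta>. \<delta> \<in> D \<Longrightarrow> integrable (M \<delta>) (\<lambda>\<omega>. (\<tau> \<delta> 1 \<omega>)\<^sup>2)"
  shows
    "((\<lambda>\<delta>. prob_space.variance (M \<delta>) (\<tau> \<delta> 1)) \<in> O[drift_at_top D](\<lambda>\<delta>. \<delta>\<^sup>2) \<longrightarrow>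
       ((\<lambda>(\<delta>, t). L1_deviation (M \<delta>) (\<tau> \<delta>) \<delta> t) \<longlongrightarrow> 0) (drift_time_limit D)) \<and>
     (\<forall>q\<in>{0..2::real}.
       (\<lambda>\<delta>. prob_space.variance (M \<delta>) (\<tau> \<delta> 1)) \<in> O[drift_at_top D](\<lambda>\<delta>. \<delta> powr q) \<longrightarrow>
       (\<forall>\<^sub>F (\<delta>, t) in drift_time_limit D. L1_deviation (M \<delta>) (\<tau> \<delta>) \<delta> t < \<infinity>) \<and>
       (\<exists>f g. f \<in> O[drift_time_limit D](\<lambda>(\<delta>, t). \<delta> / t) \<and>
         g \<in> O[drift_time_limit D](\<lambda>(\<delta>, t). sqrt (\<delta> powr (q - 1) / t)) \<and>
         (\<forall>\<^sub>F (\<delta>, t) in drift_time_limit D.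
           enn2real (L1_deviation (M \<delta>) (\<tau> \<delta>) \<delta> t) = f (\<delta>, t) + g (\<delta>, t))))"
proof -
  let ?L = "\<lambda>\<delta> t. L1_deviation (M \<delta>) (\<tau> \<delta>) \<delta> t"
  let ?V = "\<lambda>\<delta>. prob_space.variance (M \<delta>) (\<tau> \<delta> 1)"
  let ?F = "drift_time_limit D"
  note lims = filterlim_drift_time_limit[of D]
  have fst_in: "\<forall>\<^sub>F p in ?F. fst p \<in> D" and fst_top: "filterlim fst at_top ?F"
    using lims(1) by (auto simp: drift_at_top_def filterlim_inf filterlim_principal)
  have domain: "\<forall>\<^sub>F p in ?F. fst p \<in> D \<and> 1 \<le> fst p \<and> fst p \<le> snd p"
  proof -
    have "\<forall>\<^sub>F p in ?F. fst p / snd p < 1"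
      using lims(3) by (rule order_tendstoD) simp
    moreover have "\<forall>\<^sub>F p in ?F. 1 \<le> fst p"
      using fst_top by (simp add: filterlim_at_top)
    moreover have "\<forall>\<^sub>F p in ?F. 0 < snd p"
      using lims(2) by (simp add: filterlim_at_top_dense)
    ultimately show ?thesis using fst_in
      by eventually_elim (simp add: divide_less_eq)
  qed
  \<comment> \<open>This one estimate serves both claims: \<open>q = 2\<close> gives convergence,
    general \<open>q\<close> gives the rate.\<close>
  have bound: "\<exists>c\<ge>0. \<forall>\<^sub>F p in ?F.
      ?L (fst p) (snd p) \<le> ennreal (fst p / snd p + c * sqrt (fst p powr (q - 1) / snd p))"
    if q: "q \<le> 2" and O: "?V \<in> O[drift_at_top D](\<lambda>\<delta>. \<delta> powr q)" for q
  proof -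
    obtain C where C: "C > 0" "\<forall>\<^sub>F \<delta> in drift_at_top D. norm (?V \<delta>) \<le> C * norm (\<delta> powr q)"
      using landau_o.bigE[OF O] by blast
    have "\<forall>\<^sub>F p in ?F. norm (?V (fst p)) \<le> C * norm (fst p powr q)"
      using C(2) lims(1) by (rule eventually_compose_filterlim)
    then have "\<forall>\<^sub>F p in ?F. ?L (fst p) (snd p)
        \<le> ennreal (fst p / snd p + 2 * sqrt (C * (4 + C)) * sqrt (fst p powr (q - 1) / snd p))"
      using domain
    proof eventually_elim
      case (elim p)
      then have D: "fst p \<in> D" by simp
      interpret drift_walk "M (fst p)" "\<tau> (fst p)" "fst p"
        using walk[OF D] mean_integrable[OF D] mean[OF D] finite_variance[OF D] D D_pos
        by (auto simp: drift_walk_def drift_walk_axioms_def)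
      show ?case
        using elim C q by (intro L1_deviation_le_powr) auto
    qed
    then show ?thesis
      using C by (intro exI[of _ "2 * sqrt (C * (4 + C))"]) auto
  qed
  have "((\<lambda>(\<delta>, t). ?L \<delta> t) \<longlongrightarrow> 0) ?F" if O: "?V \<in> O[drift_at_top D](\<lambda>\<delta>. \<delta>\<^sup>2)"
  proof -
    have "\<forall>\<^sub>F \<delta> in drift_at_top D. 0 < \<delta>"
      using D_pos unfolding drift_at_top_def eventually_inf_principal by (intro always_eventually) auto
    \<comment> \<open>The two powers are identified for positive drifts, hence eventually along
      \<open>D\<close>.\<close>
    then have "\<forall>\<^sub>F \<delta> in drift_at_top D. \<delta>\<^sup>2 = \<delta> powr 2"
      by eventually_elim simp
    from O[unfolded landau_o.big.cong[OF this]]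
    have "?V \<in> O[drift_at_top D](\<lambda>\<delta>. \<delta> powr 2)" .
    then obtain c where c: "\<forall>\<^sub>F p in ?F.
        ?L (fst p) (snd p) \<le> ennreal (fst p / snd p + c * sqrt (fst p powr (2 - 1) / snd p))"
      using bound[of 2] by auto
    have upper: "\<forall>\<^sub>F p in ?F.
        ?L (fst p) (snd p) \<le> ennreal (fst p / snd p + c * sqrt (fst p / snd p))"
      using c domain by eventually_elim simp
    \<comment> \<open>For \<open>q = 2\<close> both error terms are functions of the ratio of drift
      to time, which tends to 0.\<close>
    have "((\<lambda>p. ennreal (fst p / snd p + c * sqrt (fst p / snd p))) \<longlongrightarrow> ennreal (0 + c * sqrt 0)) ?F"
      by (intro tendsto_intros lims)
    then have "((\<lambda>p. ?L (fst p) (snd p)) \<longlongrightarrow> 0) ?F"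
      by (intro tendsto_sandwich[OF _ upper tendsto_const]) auto
    then show ?thesis by (simp add: case_prod_beta')
  qed
  moreover have "(\<forall>\<^sub>F (\<delta>, t) in ?F. ?L \<delta> t < \<infinity>) \<and>
      (\<exists>f g. f \<in> O[?F](\<lambda>(\<delta>, t). \<delta> / t) \<and> g \<in> O[?F](\<lambda>(\<delta>, t). sqrt (\<delta> powr (q - 1) / t)) \<and>
        (\<forall>\<^sub>F (\<delta>, t) in ?F. enn2real (?L \<delta> t) = f (\<delta>, t) + g (\<delta>, t)))"
    if q: "q \<in> {0..2}" and O: "?V \<in> O[drift_at_top D](\<lambda>\<delta>. \<delta> powr q)" for q
  proof -
    let ?s = "\<lambda>p. sqrt (fst p powr (q - 1) / snd p)"
    obtain c where c: "c \<ge> 0" "\<forall>\<^sub>F p in ?F. ?L (fst p) (snd p) \<le> ennreal (fst p / snd p + c * ?s p)"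
      using bound[OF _ O] q by auto
    \<comment> \<open>Capping the deviation at the first error term makes \<open>f\<close> of that
      order; the excess \<open>g\<close> is then between 0 and \<open>c * ?s p\<close>.\<close>
    define f where "f p = min (enn2real (?L (fst p) (snd p))) (fst p / snd p)" for p
    define g where "g p = enn2real (?L (fst p) (snd p)) - f p" for p
    \<comment> \<open>Finiteness is recorded separately because \<open>enn2real\<close> sends
      \<open>\<infinity>\<close> to 0.\<close>
    have "\<forall>\<^sub>F p in ?F. ?L (fst p) (snd p) < \<infinity>"
      using c(2) by eventually_elim (simp add: order_le_less_trans[OF _ ennreal_less_top])
    moreover have "f \<in> O[?F](\<lambda>p. fst p / snd p)"
      using domain by (intro bigoI[of _ 1], eventually_elim) (auto simp: f_def)
    moreover have "g \<in> O[?F](?s)"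
    proof (rule bigoI[of _ c])
      show "\<forall>\<^sub>F p in ?F. norm (g p) \<le> c * norm (?s p)"
        using c(2) domain
      proof eventually_elim
        case (elim p)
        have s: "0 \<le> ?s p" "0 \<le> c * ?s p" "0 \<le> fst p / snd p"
          using elim c(1) by auto
        then have "enn2real (?L (fst p) (snd p)) \<le> fst p / snd p + c * ?s p"
          using elim(1) by (intro enn2real_leI) auto
        then show ?case
          using s by (auto simp: g_def f_def)
      qed
    qed
    ultimately show ?thesis
      by (intro conjI exI[of _ f] exI[of _ g]) (auto simp: case_prod_beta' g_def)
  qed
  ultimately show ?thesis by blast
qed

end
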